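(* Let $(\phi_t)_{t\ge 0}$ be a continuous one-parameter semigroup of holomorphic functions in the unit disk $\mathbb{D}$. Then every forward orbit of $(\phi_t)$ is Lipschitz; that is, for every $z\in\mathbb{D}$ the curve $\gamma_z:[0,+\infty)\to\mathbb{D}$, $\gamma_z(t)=\phi_t(z)$, is Lipschitz.
   Context: $\mathbb{D}$ is the open unit disk. A (continuous one-parameter) semigroup in $\mathbb{D}$ is a family $(\phi_t)_{t\ge0}$ of holomorphic functions $\phi_t:\mathbb{D}\to\mathbb{D}$ such that $\phi_0=\mathrm{id}_{\mathbb{D}}$, $\phi_{t+s}=\phi_t\circ\phi_s$ for all $t,s\ge0$, and $\phi_t\to\phi_0$ locally uniformly in $\mathbb{D}$ as $t\to0^+$. A function $\gamma:I\to\mathbb{C}$ on an interval $I\subset\mathbb{R}$ is Lipschitz if there is a constant $C>0$, depending only on $\gamma$, such that $|\gamma(t)-\gamma(s)|\le C|t-s|$ for all $t,s\in I$ (Euclidean distance). *)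

theory Defs
  imports "HOL-Analysis.Analysis"
begin

abbreviation unit_disk :: "complex set" (\<open>\<bbbD>\<close>)
  where "\<bbbD> \<equiv> ball 0 1"

definition locally_uniform_limit ::
    "'a::topological_space set \<Rightarrow> ('i \<Rightarrow> 'a \<Rightarrow> 'b::metric_space) \<Rightarrow> ('a \<Rightarrow> 'b) \<Rightarrow> 'i filter \<Rightarrow> bool"
  where "locally_uniform_limit S f l F \<longleftrightarrow>
    (\<forall>z\<in>S. \<exists>U. open U \<and> z \<in> U \<and> uniform_limit (U \<inter> S) f l F)"

(* phi is total in HOL: only its values phi t z with t >= 0 and z in the disk are constrained. *)
definition disk_semigroup :: "(real \<Rightarrow> complex \<Rightarrow> complex) \<Rightarrow> bool"
  where "disk_semigroup \<phi> \<longleftrightarrow>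
    (\<forall>t\<ge>0. \<phi> t holomorphic_on \<bbbD> \<and> \<phi> t ` \<bbbD> \<subseteq> \<bbbD>) \<and>
    (\<forall>z\<in>\<bbbD>. \<phi> 0 z = z) \<and>
    (\<forall>t\<ge>0. \<forall>s\<ge>0. \<forall>z\<in>\<bbbD>. \<phi> (t + s) z = \<phi> t (\<phi> s z)) \<and>
    locally_uniform_limit \<bbbD> \<phi> (\<phi> 0) (at_right 0)"

definition is_lipschitz_on :: "real set \<Rightarrow> (real \<Rightarrow> complex) \<Rightarrow> bool"
  where "is_lipschitz_on I \<gamma> \<longleftrightarrow> (\<exists>C>0. C-lipschitz_on I \<gamma>)"

definition forward_orbit :: "(real \<Rightarrow> complex \<Rightarrow> complex) \<Rightarrow> complex \<Rightarrow> real \<Rightarrow> complex"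
  where "forward_orbit \<phi> z = (\<lambda>t. \<phi> t z)"

end

theory Submission
  imports Defs "HOL-Complex_Analysis.Cauchy_Integral_Formula"
begin

text \<open>
  By Cauchy's estimate the maps \<open>\<phi>\<^sub>t\<close>, being bounded by 1, are Lipschitz near \<open>z\<close> with a constant
  that does not depend on \<open>t\<close>; as \<open>\<phi>\<^sub>t\<^sub>+\<^sub>s(z) - \<phi>\<^sub>t(z) = \<phi>\<^sub>t(\<phi>\<^sub>s(z)) - \<phi>\<^sub>t(z)\<close>, it remains to show
  \<open>|\<phi>\<^sub>s(z) - z| = O(s)\<close>. For small \<open>u\<close>, the map \<open>\<phi>\<^sub>u - id\<close> is uniformly small, hence
  \<open>1/2\<close>-Lipschitz near \<open>z\<close>, so each increment \<open>\<phi>\<^sub>k\<^sub>s(\<phi>\<^sub>s(z)) - \<phi>\<^sub>k\<^sub>s(z)\<close> with \<open>ks\<close> small is within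
  \<open>|\<phi>\<^sub>s(z) - z| / 2\<close> of \<open>\<phi>\<^sub>s(z) - z\<close>. Summing about \<open>1/s\<close> of them gives a point of the disk minus \<open>z\<close>,
  which has modulus at most 2.
\<close>

text \<open>Closed discs of radius \<open>d\<close> centred in \<open>ball z r\<close> stay inside
  \<open>ball z (r + d)\<close>, so Cauchy's estimate bounds the derivative by \<open>M / d\<close>;
  convexity of \<open>ball z r\<close> turns this into a Lipschitz bound.\<close>

lemma bounded_holomorphic_lipschitz_on:
  fixes f :: "complex \<Rightarrow> complex"
  assumes holf: "f holomorphic_on ball z (r + d)" and "d > 0"
    and bound: "\<And>w. w \<in> ball z (r + d) \<Longrightarrow> norm (f w) \<le> M"
    and x: "x \<in> ball z r" and y: "y \<in> ball z r"
  shows "norm (f x - f y) \<le> M / d * norm (x - y)"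
proof (rule field_differentiable_bound[where S = "ball z r" and f' = "deriv f"])
  fix w assume w: "w \<in> ball z r"
  have sub: "cball w d \<subseteq> ball z (r + d)"
  proof
    fix v assume "v \<in> cball w d"
    then show "v \<in> ball z (r + d)"
      using w dist_triangle[of z v w] by simp
  qed
  have "w \<in> ball z (r + d)"
    using w \<open>d > 0\<close> by simp
  then show "(f has_field_derivative deriv f w) (at w within ball z r)"
    using holf by (metis has_field_derivative_at_within holomorphic_derivI open_ball)
  have "norm ((deriv ^^ 1) f w) \<le> fact 1 * M / d ^ 1"
  proof (rule Cauchy_inequality)
    show "f holomorphic_on ball w d"
      using holf sub by (meson ball_subset_cball holomorphic_on_subset)
    show "continuous_on (cball w d) f"
      using holf sub by (meson holomorphic_on_imp_continuous_on holomorphic_on_subset)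
    show "norm (f v) \<le> M" if "norm (w - v) = d" for v
      using that sub by (intro bound) (auto simp: dist_norm)
  qed fact
  then show "norm (deriv f w) \<le> M / d" by simp
qed (use x y in auto)

context
  fixes \<phi> :: "real \<Rightarrow> complex \<Rightarrow> complex"
  assumes semigroup: "disk_semigroup \<phi>"
begin

lemma disk_semigroup_holomorphic: "t \<ge> 0 \<Longrightarrow> \<phi> t holomorphic_on \<bbbD>"
  and disk_semigroup_in_disk: "t \<ge> 0 \<Longrightarrow> z \<in> \<bbbD> \<Longrightarrow> \<phi> t z \<in> \<bbbD>"
  and disk_semigroup_zero: "z \<in> \<bbbD> \<Longrightarrow> \<phi> 0 z = z"
  and disk_semigroup_add: "t \<ge> 0 \<Longrightarrow> s \<ge> 0 \<Longrightarrow> z \<in> \<bbbD> \<Longrightarrow> \<phi> (t + s) z = \<phi> t (\<phi> s z)"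
  using semigroup unfolding disk_semigroup_def by blast+

lemma disk_semigroup_norm_diff_le:
  assumes "t \<ge> 0" "s \<ge> 0" "w \<in> \<bbbD>" "z \<in> \<bbbD>"
  shows "norm (\<phi> t w - \<phi> s z) \<le> 2"
  using disk_semigroup_in_disk[of t w] disk_semigroup_in_disk[of s z] assms
    norm_triangle_ineq4[of "\<phi> t w" "\<phi> s z"] by simp

text \<open>The radius \<open>r + r\<close> leaves a margin \<open>r\<close> for Cauchy's estimate
  on \<open>ball z r\<close>, and the bound \<open>r / 2\<close> then makes the Lipschitz constant
  of \<phi>_u - id equal to \<open>1/2\<close>.\<close>

lemma disk_semigroup_near_identity:
  assumes z: "z \<in> \<bbbD>"
  obtains r b where "r > 0" "b > 0" "ball z (r + r) \<subseteq> \<bbbD>"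
    "\<And>u w. 0 \<le> u \<Longrightarrow> u < b \<Longrightarrow> w \<in> ball z (r + r) \<Longrightarrow> norm (\<phi> u w - w) < r / 2"
proof -
  obtain U where U: "open U" "z \<in> U" "uniform_limit (U \<inter> \<bbbD>) \<phi> (\<phi> 0) (at_right 0)"
    using semigroup z unfolding disk_semigroup_def locally_uniform_limit_def by blast
  have "open (U \<inter> \<bbbD>)" "z \<in> U \<inter> \<bbbD>" using U z by auto
  then obtain e where e: "e > 0" "ball z e \<subseteq> U \<inter> \<bbbD>"
    by (meson openE)
  define r where "r = e / 2"
  have r: "r > 0" "ball z (r + r) \<subseteq> U \<inter> \<bbbD>" using e by (auto simp: r_def)
  have "\<forall>\<^sub>F u in at_right 0. \<forall>w\<in>U \<inter> \<bbbD>. dist (\<phi> u w) (\<phi> 0 w) < r / 2"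
    using U(3) r(1) by (intro uniform_limitD) auto
  then obtain b where b: "b > 0"
    "\<And>u w. 0 < u \<Longrightarrow> u < b \<Longrightarrow> w \<in> U \<inter> \<bbbD> \<Longrightarrow> dist (\<phi> u w) (\<phi> 0 w) < r / 2"
    unfolding eventually_at_right_field by blast
  show thesis
  proof (rule that[of r b])
    fix u w assume *: "0 \<le> u" "u < b" "w \<in> ball z (r + r)"
    then have "w \<in> U \<inter> \<bbbD>" using r by blast
    \<comment> \<open>The filter \<open>at_right 0\<close> says nothing about \<open>u = 0\<close>,
      where the difference vanishes.\<close>
    then show "norm (\<phi> u w - w) < r / 2"
      using b(2)[of u w] * r(1) disk_semigroup_zero[of w]
      by (cases "u = 0") (auto simp: dist_norm)
  qed (use r b in auto)
qed

lemma disk_semigroup_lipschitz_at_zero: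
  assumes z: "z \<in> \<bbbD>" and "r > 0" and sub: "ball z (r + r) \<subseteq> \<bbbD>"
    and near: "\<And>u w. 0 \<le> u \<Longrightarrow> u < b \<Longrightarrow> w \<in> ball z (r + r) \<Longrightarrow> norm (\<phi> u w - w) < r / 2"
    and s: "0 < s" "s < b"
  shows "norm (\<phi> s z - z) \<le> 8 / b * s"
proof -
  \<comment> \<open>The largest \<open>n\<close> with \<open>n * s \<le> b\<close>: every
    \<open>k < n\<close> then satisfies \<open>k * s < b\<close>, as \<open>near\<close> requires,
    and \<open>s < b\<close> gives \<open>n \<ge> 1\<close>.\<close>
  define n where "n = nat \<lfloor>b / s\<rfloor>"
  have one: "b / s \<ge> 1" using s by simp
  have n_le: "real n \<le> b / s" and n_gt: "b / s < real n + 1"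
    using one unfolding n_def by linarith+
  have "real n > 0" using n_gt one by linarith
  then have n1: "real n \<ge> 1" by simp
  let ?D = "norm (\<phi> s z - z)"
  have "\<phi> s z \<in> ball z r"
    using near[of s z] s \<open>r > 0\<close> by (simp add: dist_norm norm_minus_commute)
  have step: "norm ((\<phi> (real (Suc k) * s) z - \<phi> (real k * s) z) - (\<phi> s z - z)) \<le> ?D / 2"
    if "k < n" for k
  proof -
    let ?u = "real k * s"
    have u: "0 \<le> ?u" "?u < b"
    proof -
      have "?u < real n * s" using that s by simp
      also have "\<dots> \<le> b" using n_le s by (simp add: field_simps)
      finally show "?u < b" .
    qed (use s in simp)
    have "norm ((\<phi> ?u (\<phi> s z) - \<phi> s z) - (\<phi> ?u z - z)) \<le> (r / 2) / r * norm (\<phi> s z - z)"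
    proof (rule bounded_holomorphic_lipschitz_on[where f = "\<lambda>w. \<phi> ?u w - w"])
      show "(\<lambda>w. \<phi> ?u w - w) holomorphic_on ball z (r + r)"
        using disk_semigroup_holomorphic[OF u(1)] sub
        by (intro holomorphic_intros) (auto intro: holomorphic_on_subset)
      show "norm (\<phi> ?u w - w) \<le> r / 2" if "w \<in> ball z (r + r)" for w
        using near[OF u that] by simp
    qed (use \<open>\<phi> s z \<in> ball z r\<close> \<open>r > 0\<close> in auto)
    moreover have "\<phi> (real (Suc k) * s) z = \<phi> ?u (\<phi> s z)"
      using disk_semigroup_add[of ?u s z] u s z by (simp add: algebra_simps)
    ultimately show ?thesis using \<open>r > 0\<close> by (simp add: algebra_simps)
  qed
  \<comment> \<open>The sum of the increments collapses to a difference of two points of the disk,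
    of norm at most 2 however large \<open>n\<close> is.\<close>
  have tele: "(\<Sum>k<n. \<phi> (real (Suc k) * s) z - \<phi> (real k * s) z) = \<phi> (real n * s) z - \<phi> 0 z"
    using sum_lessThan_telescope[of "\<lambda>k. \<phi> (real k * s) z" n] by simp
  have "norm ((\<phi> (real n * s) z - \<phi> 0 z) - of_nat n * (\<phi> s z - z))
      = norm (\<Sum>k<n. (\<phi> (real (Suc k) * s) z - \<phi> (real k * s) z) - (\<phi> s z - z))"
    unfolding sum_subtractf[of _ "\<lambda>_. \<phi> s z - z"] tele by simp
  also have "\<dots> \<le> (\<Sum>k<n. ?D / 2)"
    using step by (intro sum_norm_le) auto
  finally have "norm ((\<phi> (real n * s) z - \<phi> 0 z) - of_nat n * (\<phi> s z - z)) \<le> real n * ?D / 2"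
    by simp
  moreover have "norm (of_nat n * (\<phi> s z - z)) = real n * ?D"
    by (simp add: norm_mult)
  moreover have "norm (\<phi> (real n * s) z - \<phi> 0 z) \<le> 2"
    using s z by (intro disk_semigroup_norm_diff_le) auto
  \<comment> \<open>The reverse triangle inequality gives
    \<open>n * ?D - 2 \<le> n * ?D / 2\<close>.\<close>
  ultimately have "real n * ?D \<le> 4"
    using norm_triangle_ineq3[of "\<phi> (real n * s) z - \<phi> 0 z" "of_nat n * (\<phi> s z - z)"] by linarith
  \<comment> \<open>Here \<open>b / s < n + 1 \<le> 2 * n\<close>, which doubles the 4 to the final
    8.\<close>
  moreover have "b / s * ?D \<le> (2 * real n) * ?D"
    using n_gt n1 by (intro mult_right_mono) auto
  ultimately have "b / s * ?D \<le> 8" by linarith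
  then show ?thesis using s by (simp add: field_simps)
qed

lemma disk_semigroup_orbit_lipschitz:
  assumes z: "z \<in> \<bbbD>"
  obtains C where "C > 0" "\<And>t s. t \<ge> 0 \<Longrightarrow> s \<ge> 0 \<Longrightarrow> norm (\<phi> (t + s) z - \<phi> t z) \<le> C * s"
proof -
  obtain r b where r: "r > 0" and b: "b > 0" and sub: "ball z (r + r) \<subseteq> \<bbbD>"
    and near: "\<And>u w. 0 \<le> u \<Longrightarrow> u < b \<Longrightarrow> w \<in> ball z (r + r) \<Longrightarrow> norm (\<phi> u w - w) < r / 2"
    using disk_semigroup_near_identity[OF z] by blast
  \<comment> \<open>The first summand serves \<open>s < b\<close>: the constant \<open>1 / r\<close>
    of \<phi>_t near \<open>z\<close>, uniform in \<open>t\<close>, times the rate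
    \<open>8 / b\<close> at time 0. The second serves \<open>s \<ge> b\<close>, where the trivial
    bound 2 is at most \<open>2 / b * s\<close>.\<close>
  define C where "C = 1 / r * (8 / b) + 2 / b"
  have "norm (\<phi> (t + s) z - \<phi> t z) \<le> C * s" if ts: "t \<ge> 0" "s \<ge> 0" for t s
  proof -
    consider "s = 0" | "0 < s" "s < b" | "b \<le> s" using ts by linarith
    then show ?thesis
    proof cases
      case 2
      have "norm (\<phi> t (\<phi> s z) - \<phi> t z) \<le> 1 / r * norm (\<phi> s z - z)"
      proof (rule bounded_holomorphic_lipschitz_on)
        show "\<phi> t holomorphic_on ball z (r + r)"
          using disk_semigroup_holomorphic[OF ts(1)] sub by (rule holomorphic_on_subset)
        show "norm (\<phi> t w) \<le> 1" if "w \<in> ball z (r + r)" for w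
          using disk_semigroup_in_disk[OF ts(1), of w] that sub by fastforce
        show "\<phi> s z \<in> ball z r"
          using near[of s z] 2 r by (simp add: dist_norm norm_minus_commute)
      qed (use r in auto)
      also have "\<dots> \<le> 1 / r * (8 / b * s)"
        using disk_semigroup_lipschitz_at_zero[OF z r sub near 2] r by (intro mult_left_mono) auto
      also have "\<dots> \<le> C * s"
        using b ts by (simp add: C_def algebra_simps)
      finally show ?thesis using disk_semigroup_add[OF ts z] by simp
    next
      case 3
      have "norm (\<phi> (t + s) z - \<phi> t z) \<le> 2"
        using ts z by (intro disk_semigroup_norm_diff_le) auto
      also have "2 \<le> 2 / b * s" using 3 b by (simp add: field_simps)
      also have "\<dots> \<le> C * s"
        using r b ts by (intro mult_right_mono) (auto simp: C_def)
      finally show ?thesis .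
    qed simp
  qed
  moreover have "C > 0" using r b by (simp add: C_def add_pos_pos)
  ultimately show thesis using that by blast
qed

end

theorem theorem1p2:
  fixes \<phi> :: "real \<Rightarrow> complex \<Rightarrow> complex"
  assumes "disk_semigroup \<phi>"
  shows "\<forall>z\<in>\<bbbD>. is_lipschitz_on {0..} (forward_orbit \<phi> z)"
proof
  fix z assume "z \<in> \<bbbD>"
  then obtain C where "C > 0"
    and C: "\<And>t s. t \<ge> 0 \<Longrightarrow> s \<ge> 0 \<Longrightarrow> norm (\<phi> (t + s) z - \<phi> t z) \<le> C * s"
    using disk_semigroup_orbit_lipschitz[OF assms] by blast
  have "dist (\<phi> x z) (\<phi> y z) \<le> C * dist x y" if "x \<ge> 0" "y \<ge> 0" for x y
    using that
  \<comment> \<open>By symmetry \<open>x \<le> y\<close>, so that \<open>y = x + (y - x)\<close>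
    with a nonnegative time step.\<close>
  proof (induction x y rule: linorder_wlog)
    case (le x y)
    then show ?case using C[of x "y - x"] by (simp add: dist_norm norm_minus_commute)
  next
    case (sym x y)
    then show ?case by (simp add: dist_commute)
  qed
  then have "C-lipschitz_on {0..} (forward_orbit \<phi> z)"
    using \<open>C > 0\<close> by (intro lipschitz_onI) (auto simp: forward_orbit_def)
  then show "is_lipschitz_on {0..} (forward_orbit \<phi> z)"
    using \<open>C > 0\<close> unfolding is_lipschitz_on_def by blast
qed

end
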